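(* Let $n\ge 1$ and $s\ge 2$ be integers, let $Z=\{z_1,\dots,z_s\}\subset B_2^n\subset\mathbb{R}^n$ be a set of $s$ distinct points, and let $N\ge s-1$ be an integer. For every $j\in\{1,\dots,s\}$, the angle $\theta_j$ between the row $V_N(z_j)$ and the subspace $W_j=\mathrm{span}\{V_N(z_i): i\ne j\}\subset\mathbb{R}^\nu$ satisfies $$\sin\theta_j\ge\frac{\rho(Z,j)^{s-1}}{(4n)^{s-1}\,s\,\nu}.$$
   Context: $B_2^n=\{x\in\mathbb{R}^n:\|x\|_2\le 1\}$. $\nu=\nu(n,N)=\binom{N+n}{N}$ is the number of monomials $z^\alpha=\prod_\ell z_\ell^{\alpha_\ell}$ in $n$ variables with $\alpha\in\mathbb{Z}_{\ge0}^n$, $|\alpha|=\sum_\ell\alpha_\ell\le N$. For $z\in\mathbb{R}^n$, $V_N(z)=(z^\alpha)_{|\alpha|\le N}\in\mathbb{R}^\nu$ (in a fixed ordering of the multi-indices, with $0^0=1$). The angle between a nonzero vector $x$ and a subspace $U$ is $\theta=\arcsin\left(\operatorname{dist}(x,U)/\|x\|_2\right)$, where $\operatorname{dist}$ is the Euclidean distance. The max–min projection separation is $\rho(Z,j)=\max_{\|v\|_2=1}\min_{i\ne j}|\langle v,z_j-z_i\rangle|$, the maximum being over $v\in\mathbb{R}^n$; it is positive since the points are distinct. *)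

theory Defs
  imports "HOL-Analysis.Analysis"
begin

definition multi_indices :: "nat \<Rightarrow> ('n::finite \<Rightarrow> nat) set" where
  "multi_indices N = {\<alpha>. (\<Sum>l\<in>UNIV. \<alpha> l) \<le> N}"

definition monomial_count :: "nat \<Rightarrow> nat \<Rightarrow> nat" where
  "monomial_count n N = (N + n) choose N"

text \<open>
  The Veronese row of monomials at a point. The argument \<open>e\<close> is the fixed ordering of the
  multi-indices: it labels the coordinates \<open>'m\<close> of the target space by multi-indices. If \<open>e\<close> is
  a bijection from \<open>'m\<close> onto \<open>multi_indices N\<close>, then \<open>real ^ 'm\<close> is the Euclidean space whose
  dimension is the number of monomials of degree at most \<open>N\<close>.
\<close>

definition veronese :: "('m::finite \<Rightarrow> 'n::finite \<Rightarrow> nat) \<Rightarrow> real ^ 'n \<Rightarrow> real ^ 'm" where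
  "veronese e z = (\<chi> k. \<Prod>l\<in>UNIV. (z $ l) ^ e k l)"

text \<open>Meaningful for a nonzero vector \<open>x\<close> and a subspace \<open>U\<close>.\<close>

definition subspace_angle :: "'a::euclidean_space \<Rightarrow> 'a set \<Rightarrow> real" where
  "subspace_angle x U = arcsin (infdist x U / norm x)"

text \<open>
  The max-min projection separation of \<open>z 1, \<dots>, z s\<close> at index \<open>j\<close>, for \<open>s \<ge> 2\<close>. The supremum is
  a maximum, because a continuous function of \<open>v\<close> is taken over the compact unit sphere.
\<close>

definition projection_separation :: "nat \<Rightarrow> (nat \<Rightarrow> 'a::euclidean_space) \<Rightarrow> nat \<Rightarrow> real" where
  "projection_separation s z j =
     (SUP v\<in>sphere 0 1. MIN i\<in>{1..s} - {j}. \<bar>v \<bullet> (z j - z i)\<bar>)"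

end

theory Submission
  imports Defs
begin

text \<open>
  For a unit vector \<open>v\<close>, the polynomial \<open>p x = (\<Prod>i\<noteq>j. v \<bullet> (x - z i))\<close> has degree \<open>s - 1 \<le> N\<close>, so
  \<open>p x = c \<bullet> V x\<close> where \<open>V\<close> is the Veronese map and \<open>c\<close> the vector of coefficients of \<open>p\<close>.
  Since \<open>c\<close> is orthogonal to \<open>V (z i)\<close> for \<open>i \<noteq> j\<close>, every \<open>w\<close> in their span satisfies
  \<open>\<bar>p (z j)\<bar> = \<bar>c \<bullet> (V (z j) - w)\<bar> \<le> norm c * dist (V (z j)) w\<close>.
  Expanding the product bounds the norm of \<open>c\<close> by \<open>(2n)^(s - 1)\<close>, and the norm of \<open>V (z j)\<close> is
  at most the number of monomials.
\<close>

text \<open>Stars and bars: prepending the slack \<open>N - sum \<alpha> UNIV\<close> makes a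
  multi-index a list of length n + 1 with sum exactly \<open>N\<close>. An injection suffices, as
  only an upper bound on the dimension is wanted.\<close>

lemma card_multi_indices_le:
  "card (multi_indices N :: ('n::finite \<Rightarrow> nat) set) \<le> monomial_count CARD('n) N"
proof -
  obtain xs :: "'n list" where xs: "set xs = UNIV" "distinct xs"
    using finite_distinct_list[OF finite] by metis
  have len: "length xs = CARD('n)"
    using xs distinct_card by metis
  let ?L = "{l::nat list. length l = CARD('n) + 1 \<and> sum_list l = N}"
  let ?f = "\<lambda>\<alpha>. (N - sum \<alpha> UNIV) # map \<alpha> xs"
  have card: "card ?L = monomial_count CARD('n) N"
    using card_length_sum_list[of "CARD('n) + 1" N] by (simp add: monomial_count_def)
  have "inj_on ?f (multi_indices N)"
    using xs by (auto simp: inj_on_def fun_eq_iff)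
  moreover have "?f ` multi_indices N \<subseteq> ?L"
    using xs by (auto simp: len multi_indices_def sum_list_distinct_conv_sum_set)
  moreover have "finite ?L"
    by (rule card_ge_0_finite) (simp only: card, simp add: monomial_count_def)
  ultimately show ?thesis
    unfolding card[symmetric] by (rule card_inj_on_le)
qed

text \<open>In the unit ball every monomial has absolute value at most 1, and the l1 norm dominates
  the Euclidean norm.\<close>

lemma norm_veronese_le:
  fixes e :: "'m::finite \<Rightarrow> 'n::finite \<Rightarrow> nat"
  assumes "norm x \<le> 1"
  shows "norm (veronese e x) \<le> real CARD('m)"
proof -
  have "\<bar>veronese e x $ k\<bar> \<le> 1" for k
    unfolding veronese_def vec_lambda_beta abs_prod power_abs
    using assms component_le_norm_cart[of x]
    by (intro prod_le_1 conjI power_le_one) (auto intro: order_trans)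
  then have "(\<Sum>k\<in>UNIV. \<bar>veronese e x $ k\<bar>) \<le> (\<Sum>k\<in>(UNIV::'m set). 1)"
    by (intro sum_mono)
  then show ?thesis
    using norm_le_l1_cart[of "veronese e x"] by simp
qed

text \<open>The constant monomial contributes a coordinate 1. This makes the angle of a Veronese row
  meaningful.\<close>

lemma veronese_nonzero:
  assumes "bij_betw e UNIV (multi_indices N)"
  shows "veronese e x \<noteq> 0"
proof -
  have "(\<lambda>_. 0) \<in> multi_indices N"
    by (simp add: multi_indices_def)
  then obtain k where "e k = (\<lambda>_. 0)"
    using assms by (metis bij_betw_imp_surj_on imageE)
  then have "veronese e x $ k = 1"
    by (simp add: veronese_def)
  then show ?thesis
    by auto
qed

lemma sum_UNIV_option:
  fixes f :: "'a::finite option \<Rightarrow> 'b::comm_monoid_add"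
  shows "sum f UNIV = f None + (\<Sum>l\<in>UNIV. f (Some l))"
  by (simp add: UNIV_option_conv sum.reindex)

lemma prod_affine_eq_inner_veronese:
  fixes e :: "'m::finite \<Rightarrow> 'n::finite \<Rightarrow> nat" and v :: "real ^ 'n" and a :: "'i \<Rightarrow> real"
  assumes "finite I" "card I \<le> N" and e: "multi_indices N \<subseteq> range e"
  obtains c where "norm c \<le> (\<Prod>i\<in>I. \<bar>a i\<bar> + (\<Sum>l\<in>UNIV. \<bar>v $ l\<bar>))"
    and "\<And>x. (\<Prod>i\<in>I. a i + v \<bullet> x) = c \<bullet> veronese e x"
proof -
  \<comment> \<open>\<open>None\<close> stands for the constant term, \<open>Some l\<close> for the
    term in variable \<open>l\<close>; \<open>\<alpha> g l\<close> counts how often \<open>g\<close>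
    picks that variable.\<close>
  define b where "b i o' = (case o' of None \<Rightarrow> a i | Some l \<Rightarrow> v $ l)" for i o'
  define G where "G = PiE I (\<lambda>_. UNIV :: 'n option set)"
  define \<alpha> where "\<alpha> g l = card {i\<in>I. g i = Some l}" for g :: "'i \<Rightarrow> 'n option" and l
  have "\<alpha> g \<in> multi_indices N" for g
  proof -
    have "(\<Sum>l\<in>UNIV. \<alpha> g l) = card (\<Union>l. {i\<in>I. g i = Some l})"
      unfolding \<alpha>_def using \<open>finite I\<close> by (subst card_UN_disjoint) auto
    also have "\<dots> \<le> card I"
      using \<open>finite I\<close> by (intro card_mono) auto
    finally show ?thesis
      using \<open>card I \<le> N\<close> by (simp add: multi_indices_def)
  qed
  then have "\<exists>k. e k = \<alpha> g" for g
    using e by (metis imageE subsetD)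
  then obtain k where k: "\<And>g. e (k g) = \<alpha> g"
    by metis
  \<comment> \<open>Different \<open>g\<close> may yield the same monomial; their coefficients then
    add up in one coordinate.\<close>
  define c :: "real ^ 'm" where "c = (\<Sum>g\<in>G. (\<Prod>i\<in>I. b i (g i)) *\<^sub>R axis (k g) 1)"
  show thesis
  proof
    have "norm c \<le> (\<Sum>g\<in>G. \<Prod>i\<in>I. \<bar>b i (g i)\<bar>)"
      unfolding c_def by (rule order_trans[OF norm_sum]) (simp add: abs_prod)
    also have "\<dots> = (\<Prod>i\<in>I. \<Sum>o'\<in>UNIV. \<bar>b i o'\<bar>)"
      unfolding G_def using \<open>finite I\<close> by (simp add: prod_sum_PiE)
    finally show "norm c \<le> (\<Prod>i\<in>I. \<bar>a i\<bar> + (\<Sum>l\<in>UNIV. \<bar>v $ l\<bar>))"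
      by (simp add: sum_UNIV_option b_def)
  next
    fix x
    define y :: "'n option \<Rightarrow> real" where "y o' = (case o' of None \<Rightarrow> 1 | Some l \<Rightarrow> x $ l)" for o'
    have mono: "(\<Prod>i\<in>I. y (g i)) = veronese e x $ k g" for g
    proof -
      \<comment> \<open>Padding with factors 1 over all variables lets the two products be swapped,
        which groups the picks by variable.\<close>
      have "y (g i) = (\<Prod>l\<in>UNIV. if g i = Some l then x $ l else 1)" for i
        by (cases "g i") (auto simp: y_def)
      then have "(\<Prod>i\<in>I. y (g i)) = (\<Prod>l\<in>UNIV. \<Prod>i\<in>I. if g i = Some l then x $ l else 1)"
        by (simp only:) (rule prod.swap)
      also have "\<dots> = (\<Prod>l\<in>UNIV. (x $ l) ^ \<alpha> g l)"
        unfolding \<alpha>_def using \<open>finite I\<close> by (simp add: prod.inter_filter[symmetric])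
      finally show ?thesis
        by (simp add: veronese_def k)
    qed
    have "(\<Prod>i\<in>I. a i + v \<bullet> x) = (\<Prod>i\<in>I. \<Sum>o'\<in>UNIV. b i o' * y o')"
      by (simp add: sum_UNIV_option b_def y_def inner_vec_def)
    also have "\<dots> = (\<Sum>g\<in>G. (\<Prod>i\<in>I. b i (g i)) * (\<Prod>i\<in>I. y (g i)))"
      unfolding G_def using \<open>finite I\<close> by (simp add: prod_sum_PiE prod.distrib)
    also have "\<dots> = c \<bullet> veronese e x"
      unfolding mono c_def by (simp add: inner_sum_left inner_axis')
    finally show "(\<Prod>i\<in>I. a i + v \<bullet> x) = c \<bullet> veronese e x" .
  qed
qed

text \<open>Cauchy-Schwarz, since \<open>c\<close> is orthogonal to the whole span. Dividing by a
  positive bound \<open>C\<close> instead of \<open>norm c\<close> covers \<open>c = 0\<close> as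
  well.\<close>

lemma infdist_span_ge:
  fixes x c :: "'a::real_inner"
  assumes "\<And>u. u \<in> S \<Longrightarrow> c \<bullet> u = 0" and "norm c \<le> C" "C > 0"
  shows "\<bar>c \<bullet> x\<bar> / C \<le> infdist x (span S)"
proof -
  have "\<bar>c \<bullet> x\<bar> / C \<le> dist x w" if "w \<in> span S" for w
  proof -
    have "c \<bullet> w = 0"
      using orthogonal_to_span[OF that, of c] assms(1) by (simp add: orthogonal_def)
    then have "\<bar>c \<bullet> x\<bar> = \<bar>c \<bullet> (x - w)\<bar>"
      by (simp add: inner_diff_right)
    also have "\<dots> \<le> norm c * dist x w"
      unfolding dist_norm by (rule Cauchy_Schwarz_ineq2)
    also have "\<dots> \<le> C * dist x w"
      using assms by (intro mult_right_mono) auto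
    finally show ?thesis
      using \<open>C > 0\<close> by (simp add: field_simps)
  qed
  moreover have "span S \<noteq> {}"
    using span_zero by blast
  ultimately show ?thesis
    by (simp add: infdist_notempty cINF_greatest)
qed

text \<open>Comparing with the point 0 of \<open>U\<close> puts the quotient in [0, 1], where
  \<open>sin\<close> inverts \<open>arcsin\<close>.\<close>

lemma sin_subspace_angle:
  assumes "0 \<in> U" "x \<noteq> 0"
  shows "sin (subspace_angle x U) = infdist x U / norm x"
proof -
  have "infdist x U \<le> norm x"
    using infdist_le[OF assms(1), of x] by simp
  then show ?thesis
    unfolding subspace_angle_def
    using assms infdist_nonneg[of x U] by (intro sin_arcsin) (auto intro: order_trans[of _ 0])
qed

theorem corollary2p4:
  fixes z :: "nat \<Rightarrow> real ^ 'n"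
    and e :: "'m::finite \<Rightarrow> 'n::finite \<Rightarrow> nat"
    and s N j :: nat
  assumes "s \<ge> 2"
    and "z ` {1..s} \<subseteq> cball 0 1"
    and "inj_on z {1..s}"
    and "N \<ge> s - 1"
    and "bij_betw e UNIV (multi_indices N)"
    and "j \<in> {1..s}"
  shows "sin (subspace_angle (veronese e (z j)) (span (veronese e ` z ` ({1..s} - {j}))))
           \<ge> projection_separation s z j ^ (s - 1)
              / ((4 * real CARD('n)) ^ (s - 1) * real s * real (monomial_count CARD('n) N))"
proof -
  define I where "I = {1..s} - {j}"
  define n where "n = real CARD('n)"
  define V where "V = veronese e"
  define C where "C = (2 * n) ^ (s - 1)"
  define d where "d = infdist (V (z j)) (span (V ` z ` I))"
  define m where "m v = (MIN i\<in>I. \<bar>v \<bullet> (z j - z i)\<bar>)" for v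
  have I: "finite I" "card I = s - 1" "I \<noteq> {}"
  proof -
    show "finite I" "card I = s - 1"
      using assms(6) by (auto simp: I_def)
    then show "I \<noteq> {}"
      using assms(1) by auto
  qed
  have n: "n \<ge> 1"
    by (simp add: n_def Suc_le_eq)
  then have C: "C > 0" "C \<le> (4 * n) ^ (s - 1)"
    by (auto simp: C_def intro!: power_mono)
  have z: "norm (z i) \<le> 1" if "i \<in> {1..s}" for i
    using subsetD[OF assms(2) imageI[OF that]] by simp
  have m_nonneg: "m v \<ge> 0" for v
    using I by (simp add: m_def)
  have d_nonneg: "d \<ge> 0"
    by (simp add: d_def infdist_nonneg)

  have main: "m v ^ (s - 1) \<le> C * d" if v: "norm v = 1" for v
  proof -
    have range: "multi_indices N \<subseteq> range e"
      using assms(5) by (simp add: bij_betw_def)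
    obtain c where c: "norm c \<le> (\<Prod>i\<in>I. \<bar>- (v \<bullet> z i)\<bar> + (\<Sum>l\<in>UNIV. \<bar>v $ l\<bar>))"
      and p: "\<And>x. (\<Prod>i\<in>I. - (v \<bullet> z i) + v \<bullet> x) = c \<bullet> V x"
      using prod_affine_eq_inner_veronese[of I N e "\<lambda>i. - (v \<bullet> z i)" v] I assms(4) range
      unfolding V_def by metis
    \<comment> \<open>The constant term is at most 1, the l1 norm of a unit vector at most
      \<open>n\<close>, and 1 + n \<le> 2n.\<close>
    have "\<bar>- (v \<bullet> z i)\<bar> + (\<Sum>l\<in>UNIV. \<bar>v $ l\<bar>) \<le> 2 * n" if "i \<in> I" for i
    proof -
      have "\<bar>v \<bullet> z i\<bar> \<le> 1"
        using Cauchy_Schwarz_ineq2[of v "z i"] v z[of i] that by (simp add: I_def)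
      moreover have "(\<Sum>l\<in>UNIV. \<bar>v $ l\<bar>) \<le> (\<Sum>l\<in>(UNIV::'n set). 1)"
        using component_le_norm_cart[of v] v by (intro sum_mono) simp
      ultimately show ?thesis
        using n by (simp flip: n_def)
    qed
    then have "(\<Prod>i\<in>I. \<bar>- (v \<bullet> z i)\<bar> + (\<Sum>l\<in>UNIV. \<bar>v $ l\<bar>)) \<le> (\<Prod>i\<in>I. 2 * n)"
      by (intro prod_mono conjI add_nonneg_nonneg sum_nonneg) auto
    with c have norm_c: "norm c \<le> C"
      using I by (simp add: C_def)
    have "c \<bullet> V (z i) = 0" if "i \<in> I" for i
      using that I unfolding p[symmetric] by (intro prod_zero) auto
    then have "\<bar>c \<bullet> V (z j)\<bar> / C \<le> d"
      unfolding d_def by (intro infdist_span_ge norm_c C) auto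
    then have "\<bar>c \<bullet> V (z j)\<bar> \<le> C * d"
      using C by (simp add: field_simps)
    \<comment> \<open>At \<open>z j\<close> each factor is \<open>v \<bullet> (z j - z i)\<close>,
      whose absolute value is at least the minimum \<open>m v\<close>.\<close>
    moreover have "(\<Prod>i\<in>I. m v) \<le> (\<Prod>i\<in>I. \<bar>- (v \<bullet> z i) + v \<bullet> z j\<bar>)"
      using I m_nonneg by (intro prod_mono) (auto simp: m_def inner_diff_right)
    ultimately show ?thesis
      using I by (simp add: p[symmetric] abs_prod)
  qed

  define \<rho> where "\<rho> = projection_separation s z j"
  have \<rho>_eq: "\<rho> = (SUP v\<in>sphere 0 1. m v)"
    by (simp add: \<rho>_def projection_separation_def m_def I_def)
  have s: "s - 1 > 0"
    using assms(1) by simp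
  obtain u :: "real ^ 'n" where u: "norm u = 1"
    using vector_choose_size[of 1] by auto
  \<comment> \<open>Taking roots bounds \<open>m v\<close> itself uniformly in \<open>v\<close>, so
    the bound passes to the supremum without showing that it is attained.\<close>
  have root: "m v \<le> root (s - 1) (C * d)" if "norm v = 1" for v
    using real_root_le_mono[OF s main[OF that]] s m_nonneg by (simp add: real_root_power_cancel)
  have "\<rho> \<le> root (s - 1) (C * d)"
    unfolding \<rho>_eq using u root by (intro cSUP_least) auto
  \<comment> \<open>Needed for monotonicity of the power; the same root bound shows that the
    supremum is over a set bounded above.\<close>
  moreover have "0 \<le> \<rho>"
    unfolding \<rho>_eq using u root m_nonneg[of u]
    by (intro cSUP_upper2[where x = u]) (auto intro!: bdd_aboveI2)
  ultimately have "\<rho> ^ (s - 1) \<le> root (s - 1) (C * d) ^ (s - 1)"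
    by (intro power_mono)
  also have "\<dots> = C * d"
    using s C d_nonneg by simp
  finally have \<rho>: "\<rho> ^ (s - 1) \<le> C * d" .

  define \<nu> where "\<nu> = real (monomial_count CARD('n) N)"
  have "CARD('m) = card (multi_indices N :: ('n \<Rightarrow> nat) set)"
    using assms(5) by (rule bij_betw_same_card)
  then have "real CARD('m) \<le> \<nu>"
    using card_multi_indices_le[where 'n='n, of N] by (simp add: \<nu>_def)
  then have norm_V: "norm (V (z j)) \<le> \<nu>"
    using norm_veronese_le[OF z[OF assms(6)], of e] by (simp add: V_def)
  have V_pos: "norm (V (z j)) > 0"
    using veronese_nonzero[OF assms(5)] by (simp add: V_def)
  \<comment> \<open>The constants obtained are weakened here to those claimed: 2n to 4n, and
    \<open>\<nu>\<close> to s times \<open>\<nu>\<close>.\<close>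
  have "C * norm (V (z j)) \<le> (4 * n) ^ (s - 1) * (real s * \<nu>)"
  proof (rule mult_mono[OF C(2)])
    have "1 * \<nu> \<le> real s * \<nu>"
      using assms(1) by (intro mult_right_mono) (auto simp: \<nu>_def)
    with norm_V show "norm (V (z j)) \<le> real s * \<nu>"
      by simp
  qed (use n in auto)
  then have "\<rho> ^ (s - 1) / ((4 * n) ^ (s - 1) * real s * \<nu>) \<le> C * d / (C * norm (V (z j)))"
    using \<rho> C V_pos d_nonneg by (intro frac_le) (auto simp: mult.assoc)
  also have "\<dots> = d / norm (V (z j))"
    using C by simp
  also have "\<dots> = sin (subspace_angle (V (z j)) (span (V ` z ` I)))"
    unfolding d_def using V_pos by (intro sin_subspace_angle[symmetric] span_zero) auto
  finally show ?thesis
    by (simp add: V_def I_def \<rho>_def \<nu>_def n_def)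
qed

end
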